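(* Let $\mathcal C$ be a balanced factorization category, $f:X\to Y$ a map in $\mathcal C$ and $x,y:1\to X$ points. The map $f_{x,y}:X(x,y)\to Y(fx,fy)$ enriches both $\overline f_{x,y}:\overline X(x,y)\to\overline Y(fx,fy)$ and $\overline f'_{y,x}:\overline X'(y,x)\to\overline Y'(fy,fx)$. That is, for every $\alpha:1\to X(x,y)$: the left arrow $fx\to fy$ of $Y$ corresponding to $f_{x,y}\circ\alpha$ is the image under $\overline f$ of the left arrow $x\to y$ corresponding to $\alpha$, and the right arrow $fy\to fx$ of $Y$ corresponding to $f_{x,y}\circ\alpha$ is the image under $\overline f'$ of the right arrow $y\to x$ corresponding to $\alpha$.
   Context: A balanced factorization category is a finitely complete category $\mathcal C$ with two (orthogonal) factorization systems $(\mathcal E,\mathcal M)$ and $(\mathcal E',\mathcal M')$ such that $\mathcal M/1=\mathcal M'/1$ (an object $S$ has $S\to 1$ in $\mathcal M$ iff in $\mathcal M'$), and such that the pullback of a map in $\mathcal E$ along a map in $\mathcal M'$ is in $\mathcal E$, and the pullback of a map in $\mathcal E'$ along a map in $\mathcal M$ is in $\mathcal E'$. Factorizations are chosen. Internal sets are the objects $S$ with $S\to1$ in $\mathcal M$ (equivalently $\mathcal M'$); they form a reflective full subcategory $\mathcal S$ with reflection $\pi_0:\mathcal C\to\mathcal S$. A point $x:1\to X$ factors as $1\xrightarrow{e_x}X/x\xrightarrow{\downarrow x}X$ with $e_x\in\mathcal E$, $\downarrow x\in\mathcal M$ (slice), and as $1\xrightarrow{i_x}x\backslash X\xrightarrow{\uparrow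 x}X$ with $i_x\in\mathcal E'$, $\uparrow x\in\mathcal M'$ (coslice). A left arrow $x\to y$ of $X$ (element of $\overline X(x,y)$) is a map $1\to X/y$ over the point $x$; a right arrow $y\to x$ (element of $\overline X'(y,x)$) is a map $1\to x\backslash X$ over the point $y$. For $f:X\to Y$, $e_{f,y}:X/y\to Y/fy$ is the unique map in $\mathcal E$ with $(\downarrow fy)e_{f,y}=f(\downarrow y)$ and $e_{f,y}e_y=e_{fy}$, and $\overline f$ sends a left arrow $\alpha:1\to X/y$ to $e_{f,y}\alpha$; dually $i_{f,x}:x\backslash X\to fx\backslash Y$ is the unique map in $\mathcal E'$ with $(\uparrow fx)i_{f,x}=f(\uparrow x)$ and $i_{f,x}i_x=i_{fx}$, and $\overline f'$ sends a right arrow $\alpha:1\to x\backslash X$ to $i_{f,x}\alpha$. $X[x,y]$ (or $[x,y]$) is the pullback of $\uparrow x:x\backslash X\to X$ and $\downarrow y:X/y\to X$, with projections $p_{x,y}:[x,y]\to x\backslash X$ and $q_{x,y}:[x,y]\to X/y$; $X(x,y):=\pi_0[x,y]$ with reflection map $c_{x,y}:[x,y]\to X(x,y)$. Let $i:S\to[x,y]$ be the pullback of $i_x$ along $p_{x,y}$ and $e:S'\to[x,y]$ the pullback of $e_y$ along $q_{x,y}$; then $c_{x,y}i$ and $c_{x,y}e$ are isomorphisms, and one sets $i_{x,y}:=i(c_{x,y}i)^{-1}$, $e_{x,y}:=e(c_{x,y}e)^{-1}$. The left arrow $x\to y$ corresponding to $\alpha:1\to X(x,y)$ is $q_{x,y}i_{x,y}\alpha$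 and the right arrow $y\to x$ corresponding to $\alpha$ is $p_{x,y}e_{x,y}\alpha$. The map $f_{[x,y]}:X[x,y]\to Y[fx,fy]$ is induced on pullbacks by $i_{f,x}$, $e_{f,y}$ and $f$, and $f_{x,y}:=\pi_0(f_{[x,y]})$. *)

theory Defs
  imports Main
begin

section \<open>Categories and finite limits\<close>

record ('o, 'm) cat =
  Ob :: "'o set"
  Ar :: "'m set"
  Dom :: "'m \<Rightarrow> 'o"
  Cod :: "'m \<Rightarrow> 'o"
  Idm :: "'o \<Rightarrow> 'm"
  Comp :: "'m \<Rightarrow> 'm \<Rightarrow> 'm"  (infixl "\<cdot>\<index>" 70)

text \<open>Composition is in applicative order: \<open>g \<cdot> f\<close> is meaningful when \<open>Dom g = Cod f\<close>.\<close>

definition Hom :: "('o, 'm) cat \<Rightarrow> 'o \<Rightarrow> 'o \<Rightarrow> 'm set" where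
  "Hom C A B = {f \<in> Ar C. Dom C f = A \<and> Cod C f = B}"

locale category =
  fixes C :: "('o, 'm) cat" (structure)
  assumes Dom_Ob: "f \<in> Ar C \<Longrightarrow> Dom C f \<in> Ob C"
    and Cod_Ob: "f \<in> Ar C \<Longrightarrow> Cod C f \<in> Ob C"
    and Idm_Hom: "A \<in> Ob C \<Longrightarrow> Idm C A \<in> Hom C A A"
    and Comp_Hom: "\<lbrakk>f \<in> Hom C A B; g \<in> Hom C B D\<rbrakk> \<Longrightarrow> g \<cdot> f \<in> Hom C A D"
    and Idm_left: "f \<in> Hom C A B \<Longrightarrow> Idm C B \<cdot> f = f"
    and Idm_right: "f \<in> Hom C A B \<Longrightarrow> f \<cdot> Idm C A = f"
    and Comp_assoc: "\<lbrakk>f \<in> Hom C A B; g \<in> Hom C B D; h \<in> Hom C D G\<rbrakk>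
      \<Longrightarrow> (h \<cdot> g) \<cdot> f = h \<cdot> (g \<cdot> f)"

definition is_functor ::
  "('a, 'b) cat \<Rightarrow> ('o, 'm) cat \<Rightarrow> ('a \<Rightarrow> 'o) \<Rightarrow> ('b \<Rightarrow> 'm) \<Rightarrow> bool" where
  "is_functor J C Fo Fa \<longleftrightarrow>
     (\<forall>a \<in> Ob J. Fo a \<in> Ob C) \<and>
     (\<forall>u \<in> Ar J. Fa u \<in> Hom C (Fo (Dom J u)) (Fo (Cod J u))) \<and>
     (\<forall>a \<in> Ob J. Fa (Idm J a) = Idm C (Fo a)) \<and>
     (\<forall>u \<in> Ar J. \<forall>v \<in> Ar J. Cod J u = Dom J v \<longrightarrow>
        Fa (v \<cdot>\<^bsub>J\<^esub> u) = Fa v \<cdot>\<^bsub>C\<^esub> Fa u)"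

definition is_cone ::
  "('a, 'b) cat \<Rightarrow> ('o, 'm) cat \<Rightarrow> ('a \<Rightarrow> 'o) \<Rightarrow> ('b \<Rightarrow> 'm) \<Rightarrow> 'o \<Rightarrow> ('a \<Rightarrow> 'm) \<Rightarrow> bool" where
  "is_cone J C Fo Fa L l \<longleftrightarrow>
     L \<in> Ob C \<and> (\<forall>a \<in> Ob J. l a \<in> Hom C L (Fo a)) \<and>
     (\<forall>u \<in> Ar J. Fa u \<cdot>\<^bsub>C\<^esub> l (Dom J u) = l (Cod J u))"

definition is_limit ::
  "('a, 'b) cat \<Rightarrow> ('o, 'm) cat \<Rightarrow> ('a \<Rightarrow> 'o) \<Rightarrow> ('b \<Rightarrow> 'm) \<Rightarrow> 'o \<Rightarrow> ('a \<Rightarrow> 'm) \<Rightarrow> bool" where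
  "is_limit J C Fo Fa L l \<longleftrightarrow>
     is_cone J C Fo Fa L l \<and>
     (\<forall>N n. is_cone J C Fo Fa N n \<longrightarrow>
        (\<exists>!h. h \<in> Hom C N L \<and> (\<forall>a \<in> Ob J. l a \<cdot>\<^bsub>C\<^esub> h = n a)))"

text \<open>Every finite category is isomorphic to one whose objects and arrows are natural
  numbers, so it is no restriction to take finite diagram shapes of type \<open>(nat, nat) cat\<close>.\<close>

definition finitely_complete :: "('o, 'm) cat \<Rightarrow> bool" where
  "finitely_complete C \<longleftrightarrow>
     (\<forall>(J :: (nat, nat) cat) Fo Fa.
        category J \<and> finite (Ob J) \<and> finite (Ar J) \<and> is_functor J C Fo Fa
        \<longrightarrow> (\<exists>L l. is_limit J C Fo Fa L l))"

definition is_terminal :: "('o, 'm) cat \<Rightarrow> 'o \<Rightarrow> bool" where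
  "is_terminal C T \<longleftrightarrow> T \<in> Ob C \<and> (\<forall>A \<in> Ob C. \<exists>!u. u \<in> Hom C A T)"

text \<open>\<open>is_pullback C f g p q\<close>: \<open>f \<cdot> p = g \<cdot> q\<close> is a pullback square; so \<open>p\<close> is the
  pullback of \<open>g\<close> along \<open>f\<close>, and \<open>q\<close> is the pullback of \<open>f\<close> along \<open>g\<close>.\<close>

definition is_pullback :: "('o, 'm) cat \<Rightarrow> 'm \<Rightarrow> 'm \<Rightarrow> 'm \<Rightarrow> 'm \<Rightarrow> bool" where
  "is_pullback C f g p q \<longleftrightarrow>
     f \<in> Ar C \<and> g \<in> Ar C \<and> Cod C f = Cod C g \<and>
     p \<in> Hom C (Dom C p) (Dom C f) \<and> q \<in> Hom C (Dom C p) (Dom C g) \<and>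
     f \<cdot>\<^bsub>C\<^esub> p = g \<cdot>\<^bsub>C\<^esub> q \<and>
     (\<forall>Z. \<forall>a \<in> Hom C Z (Dom C f). \<forall>b \<in> Hom C Z (Dom C g).
        f \<cdot>\<^bsub>C\<^esub> a = g \<cdot>\<^bsub>C\<^esub> b \<longrightarrow>
        (\<exists>!h. h \<in> Hom C Z (Dom C p) \<and> p \<cdot>\<^bsub>C\<^esub> h = a \<and> q \<cdot>\<^bsub>C\<^esub> h = b))"

definition inverse_arrows :: "('o, 'm) cat \<Rightarrow> 'm \<Rightarrow> 'm \<Rightarrow> bool" where
  "inverse_arrows C f g \<longleftrightarrow>
     f \<in> Ar C \<and> g \<in> Hom C (Cod C f) (Dom C f) \<and>
     g \<cdot>\<^bsub>C\<^esub> f = Idm C (Dom C f) \<and> f \<cdot>\<^bsub>C\<^esub> g = Idm C (Cod C f)"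

definition is_iso :: "('o, 'm) cat \<Rightarrow> 'm \<Rightarrow> bool" where
  "is_iso C f \<longleftrightarrow> (\<exists>g. inverse_arrows C f g)"

definition inverse_arrow :: "('o, 'm) cat \<Rightarrow> 'm \<Rightarrow> 'm" where
  "inverse_arrow C f = (THE g. inverse_arrows C f g)"


section \<open>Balanced factorization categories\<close>

definition is_factorization :: "('o, 'm) cat \<Rightarrow> 'm set \<Rightarrow> 'm set \<Rightarrow> 'm \<Rightarrow> 'm \<Rightarrow> 'm \<Rightarrow> bool" where
  "is_factorization C E M f e m \<longleftrightarrow>
     e \<in> E \<and> m \<in> M \<and> e \<in> Hom C (Dom C f) (Dom C m) \<and> m \<in> Hom C (Dom C m) (Cod C f) \<and>
     m \<cdot>\<^bsub>C\<^esub> e = f"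

definition orthogonal :: "('o, 'm) cat \<Rightarrow> 'm \<Rightarrow> 'm \<Rightarrow> bool" where
  "orthogonal C e m \<longleftrightarrow>
     (\<forall>a \<in> Hom C (Dom C e) (Dom C m). \<forall>b \<in> Hom C (Cod C e) (Cod C m).
        m \<cdot>\<^bsub>C\<^esub> a = b \<cdot>\<^bsub>C\<^esub> e \<longrightarrow>
        (\<exists>!d. d \<in> Hom C (Cod C e) (Dom C m) \<and> d \<cdot>\<^bsub>C\<^esub> e = a \<and> m \<cdot>\<^bsub>C\<^esub> d = b))"

definition factorization_system :: "('o, 'm) cat \<Rightarrow> 'm set \<Rightarrow> 'm set \<Rightarrow> bool" where
  "factorization_system C E M \<longleftrightarrow>
     E \<subseteq> Ar C \<and> M \<subseteq> Ar C \<and>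
     (\<forall>f. is_iso C f \<longrightarrow> f \<in> E \<and> f \<in> M) \<and>
     (\<forall>f \<in> E. \<forall>g \<in> E. Cod C f = Dom C g \<longrightarrow> g \<cdot>\<^bsub>C\<^esub> f \<in> E) \<and>
     (\<forall>f \<in> M. \<forall>g \<in> M. Cod C f = Dom C g \<longrightarrow> g \<cdot>\<^bsub>C\<^esub> f \<in> M) \<and>
     (\<forall>e \<in> E. \<forall>m \<in> M. orthogonal C e m) \<and>
     (\<forall>f \<in> Ar C. \<exists>e m. is_factorization C E M f e m)"

locale balanced_factorization_category = category C
  for C :: "('o, 'm) cat" (structure) +
  fixes E M E' M' :: "'m set"
  assumes finitely_complete: "finitely_complete C"
    and factorization_system: "factorization_system C E M"
    and factorization_system': "factorization_system C E' M'"
    and M_over_1: "\<lbrakk>is_terminal C T; s \<in> Hom C S T\<rbrakk> \<Longrightarrow> s \<in> M \<longleftrightarrow> s \<in> M'"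
    and E_stable: "\<lbrakk>e \<in> E; m \<in> M'; is_pullback C e m p q\<rbrakk> \<Longrightarrow> q \<in> E"
    and E'_stable: "\<lbrakk>e \<in> E'; m \<in> M; is_pullback C e m p q\<rbrakk> \<Longrightarrow> q \<in> E'"

definition internal_set :: "('o, 'm) cat \<Rightarrow> 'm set \<Rightarrow> 'o \<Rightarrow> 'o \<Rightarrow> bool" where
  "internal_set C M T S \<longleftrightarrow> S \<in> Ob C \<and> (\<exists>s \<in> Hom C S T. s \<in> M)"

definition is_reflection :: "('o, 'm) cat \<Rightarrow> ('o \<Rightarrow> bool) \<Rightarrow> 'o \<Rightarrow> 'm \<Rightarrow> bool" where
  "is_reflection C P X c \<longleftrightarrow>
     c \<in> Hom C X (Cod C c) \<and> P (Cod C c) \<and>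
     (\<forall>S g. P S \<and> g \<in> Hom C X S \<longrightarrow> (\<exists>!h. h \<in> Hom C (Cod C c) S \<and> h \<cdot>\<^bsub>C\<^esub> c = g))"

text \<open>The constructions below depend on choices: a terminal object, pullbacks of all
  cospans, both factorizations of all maps, and the reflection of every object in the internal
  sets.  Such choices always exist (lemma \<open>choices_exist\<close>), and they are left arbitrary.\<close>

record ('o, 'm) choices =
  one :: 'o
  pb1 :: "'m \<Rightarrow> 'm \<Rightarrow> 'm"
  pb2 :: "'m \<Rightarrow> 'm \<Rightarrow> 'm"
  facE :: "'m \<Rightarrow> 'm"
  facM :: "'m \<Rightarrow> 'm"
  facE' :: "'m \<Rightarrow> 'm"
  facM' :: "'m \<Rightarrow> 'm"
  refl_map :: "'o \<Rightarrow> 'm"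

definition valid_choices ::
  "('o, 'm) cat \<Rightarrow> 'm set \<Rightarrow> 'm set \<Rightarrow> 'm set \<Rightarrow> 'm set \<Rightarrow> ('o, 'm) choices \<Rightarrow> bool" where
  "valid_choices C E M E' M' K \<longleftrightarrow>
     is_terminal C (one K) \<and>
     (\<forall>f \<in> Ar C. \<forall>g \<in> Ar C. Cod C f = Cod C g \<longrightarrow> is_pullback C f g (pb1 K f g) (pb2 K f g)) \<and>
     (\<forall>f \<in> Ar C. is_factorization C E M f (facE K f) (facM K f)) \<and>
     (\<forall>f \<in> Ar C. is_factorization C E' M' f (facE' K f) (facM' K f)) \<and>
     (\<forall>X \<in> Ob C. is_reflection C (internal_set C M (one K)) X (refl_map K X))"


section \<open>Slices, coslices and arrows\<close>

text \<open>A point \<open>x : 1 \<rightarrow> X\<close> determines \<open>X\<close>, which is therefore not an argument.\<close>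

definition slice_pt :: "('o, 'm) choices \<Rightarrow> 'm \<Rightarrow> 'm" where  \<comment> \<open>\<open>e\<^sub>x : 1 \<rightarrow> X/x\<close>\<close>
  "slice_pt K x = facE K x"

definition slice_map :: "('o, 'm) choices \<Rightarrow> 'm \<Rightarrow> 'm" where  \<comment> \<open>\<open>\<down>x : X/x \<rightarrow> X\<close>\<close>
  "slice_map K x = facM K x"

definition slice :: "('o, 'm) cat \<Rightarrow> ('o, 'm) choices \<Rightarrow> 'm \<Rightarrow> 'o" where
  "slice C K x = Dom C (slice_map K x)"

definition coslice_pt :: "('o, 'm) choices \<Rightarrow> 'm \<Rightarrow> 'm" where  \<comment> \<open>\<open>i\<^sub>x\<close> from \<open>1\<close> to the coslice\<close>
  "coslice_pt K x = facE' K x"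

definition coslice_map :: "('o, 'm) choices \<Rightarrow> 'm \<Rightarrow> 'm" where  \<comment> \<open>\<open>\<up>x\<close> from the coslice to \<open>X\<close>\<close>
  "coslice_map K x = facM' K x"

definition coslice :: "('o, 'm) cat \<Rightarrow> ('o, 'm) choices \<Rightarrow> 'm \<Rightarrow> 'o" where
  "coslice C K x = Dom C (coslice_map K x)"

text \<open>\<open>left_arrows C K x y\<close> are the left arrows \<open>x \<rightarrow> y\<close>, and \<open>right_arrows C K y x\<close> are the
  right arrows \<open>y \<rightarrow> x\<close>.\<close>

definition left_arrows :: "('o, 'm) cat \<Rightarrow> ('o, 'm) choices \<Rightarrow> 'm \<Rightarrow> 'm \<Rightarrow> 'm set" where
  "left_arrows C K x y = {a \<in> Hom C (one K) (slice C K y). slice_map K y \<cdot>\<^bsub>C\<^esub> a = x}"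

definition right_arrows :: "('o, 'm) cat \<Rightarrow> ('o, 'm) choices \<Rightarrow> 'm \<Rightarrow> 'm \<Rightarrow> 'm set" where
  "right_arrows C K y x = {a \<in> Hom C (one K) (coslice C K x). coslice_map K x \<cdot>\<^bsub>C\<^esub> a = y}"

definition slice_ext ::  \<comment> \<open>\<open>e\<^bsub>f,y\<^esub>\<close>\<close>
  "('o, 'm) cat \<Rightarrow> 'm set \<Rightarrow> ('o, 'm) choices \<Rightarrow> 'm \<Rightarrow> 'm \<Rightarrow> 'm" where
  "slice_ext C E K f y = (THE d. d \<in> E \<and>
     d \<in> Hom C (slice C K y) (slice C K (f \<cdot>\<^bsub>C\<^esub> y)) \<and>
     slice_map K (f \<cdot>\<^bsub>C\<^esub> y) \<cdot>\<^bsub>C\<^esub> d = f \<cdot>\<^bsub>C\<^esub> slice_map K y \<and>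
     d \<cdot>\<^bsub>C\<^esub> slice_pt K y = slice_pt K (f \<cdot>\<^bsub>C\<^esub> y))"

definition coslice_ext ::  \<comment> \<open>\<open>i\<^bsub>f,x\<^esub>\<close>\<close>
  "('o, 'm) cat \<Rightarrow> 'm set \<Rightarrow> ('o, 'm) choices \<Rightarrow> 'm \<Rightarrow> 'm \<Rightarrow> 'm" where
  "coslice_ext C E' K f x = (THE d. d \<in> E' \<and>
     d \<in> Hom C (coslice C K x) (coslice C K (f \<cdot>\<^bsub>C\<^esub> x)) \<and>
     coslice_map K (f \<cdot>\<^bsub>C\<^esub> x) \<cdot>\<^bsub>C\<^esub> d = f \<cdot>\<^bsub>C\<^esub> coslice_map K x \<and>
     d \<cdot>\<^bsub>C\<^esub> coslice_pt K x = coslice_pt K (f \<cdot>\<^bsub>C\<^esub> x))"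

definition left_image ::
  "('o, 'm) cat \<Rightarrow> 'm set \<Rightarrow> ('o, 'm) choices \<Rightarrow> 'm \<Rightarrow> 'm \<Rightarrow> 'm \<Rightarrow> 'm" where
  "left_image C E K f y a = slice_ext C E K f y \<cdot>\<^bsub>C\<^esub> a"

definition right_image ::
  "('o, 'm) cat \<Rightarrow> 'm set \<Rightarrow> ('o, 'm) choices \<Rightarrow> 'm \<Rightarrow> 'm \<Rightarrow> 'm \<Rightarrow> 'm" where
  "right_image C E' K f x a = coslice_ext C E' K f x \<cdot>\<^bsub>C\<^esub> a"


section \<open>The internal hom-sets\<close>

definition p_map :: "('o, 'm) choices \<Rightarrow> 'm \<Rightarrow> 'm \<Rightarrow> 'm" where
  "p_map K x y = pb1 K (coslice_map K x) (slice_map K y)"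

definition q_map :: "('o, 'm) choices \<Rightarrow> 'm \<Rightarrow> 'm \<Rightarrow> 'm" where
  "q_map K x y = pb2 K (coslice_map K x) (slice_map K y)"

definition bracket :: "('o, 'm) cat \<Rightarrow> ('o, 'm) choices \<Rightarrow> 'm \<Rightarrow> 'm \<Rightarrow> 'o" where
  "bracket C K x y = Dom C (p_map K x y)"  \<comment> \<open>\<open>X[x,y]\<close>\<close>

definition c_map :: "('o, 'm) cat \<Rightarrow> ('o, 'm) choices \<Rightarrow> 'm \<Rightarrow> 'm \<Rightarrow> 'm" where
  "c_map C K x y = refl_map K (bracket C K x y)"

definition pi0_ob :: "('o, 'm) cat \<Rightarrow> ('o, 'm) choices \<Rightarrow> 'o \<Rightarrow> 'o" where
  "pi0_ob C K A = Cod C (refl_map K A)"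

definition pi0_map :: "('o, 'm) cat \<Rightarrow> ('o, 'm) choices \<Rightarrow> 'm \<Rightarrow> 'm" where
  "pi0_map C K g = (THE h. h \<in> Hom C (pi0_ob C K (Dom C g)) (pi0_ob C K (Cod C g)) \<and>
     h \<cdot>\<^bsub>C\<^esub> refl_map K (Dom C g) = refl_map K (Cod C g) \<cdot>\<^bsub>C\<^esub> g)"

definition internal_hom :: "('o, 'm) cat \<Rightarrow> ('o, 'm) choices \<Rightarrow> 'm \<Rightarrow> 'm \<Rightarrow> 'o" where
  "internal_hom C K x y = pi0_ob C K (bracket C K x y)"  \<comment> \<open>\<open>X(x,y)\<close>\<close>

definition i_section :: "('o, 'm) cat \<Rightarrow> ('o, 'm) choices \<Rightarrow> 'm \<Rightarrow> 'm \<Rightarrow> 'm" where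
  "i_section C K x y =
     (let i = pb2 K (coslice_pt K x) (p_map K x y)
      in i \<cdot>\<^bsub>C\<^esub> inverse_arrow C (c_map C K x y \<cdot>\<^bsub>C\<^esub> i))"

definition e_section :: "('o, 'm) cat \<Rightarrow> ('o, 'm) choices \<Rightarrow> 'm \<Rightarrow> 'm \<Rightarrow> 'm" where
  "e_section C K x y =
     (let e = pb2 K (slice_pt K y) (q_map K x y)
      in e \<cdot>\<^bsub>C\<^esub> inverse_arrow C (c_map C K x y \<cdot>\<^bsub>C\<^esub> e))"

definition left_arrow_of :: "('o, 'm) cat \<Rightarrow> ('o, 'm) choices \<Rightarrow> 'm \<Rightarrow> 'm \<Rightarrow> 'm \<Rightarrow> 'm" where
  "left_arrow_of C K x y \<alpha> = q_map K x y \<cdot>\<^bsub>C\<^esub> i_section C K x y \<cdot>\<^bsub>C\<^esub> \<alpha>"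

definition right_arrow_of :: "('o, 'm) cat \<Rightarrow> ('o, 'm) choices \<Rightarrow> 'm \<Rightarrow> 'm \<Rightarrow> 'm \<Rightarrow> 'm" where
  "right_arrow_of C K x y \<alpha> = p_map K x y \<cdot>\<^bsub>C\<^esub> e_section C K x y \<cdot>\<^bsub>C\<^esub> \<alpha>"

definition bracket_map ::  \<comment> \<open>\<open>f\<^bsub>[x,y]\<^esub>\<close>\<close>
  "('o, 'm) cat \<Rightarrow> 'm set \<Rightarrow> 'm set \<Rightarrow> ('o, 'm) choices \<Rightarrow> 'm \<Rightarrow> 'm \<Rightarrow> 'm \<Rightarrow> 'm" where
  "bracket_map C E E' K f x y =
     (THE h. h \<in> Hom C (bracket C K x y) (bracket C K (f \<cdot>\<^bsub>C\<^esub> x) (f \<cdot>\<^bsub>C\<^esub> y)) \<and>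
        p_map K (f \<cdot>\<^bsub>C\<^esub> x) (f \<cdot>\<^bsub>C\<^esub> y) \<cdot>\<^bsub>C\<^esub> h = coslice_ext C E' K f x \<cdot>\<^bsub>C\<^esub> p_map K x y \<and>
        q_map K (f \<cdot>\<^bsub>C\<^esub> x) (f \<cdot>\<^bsub>C\<^esub> y) \<cdot>\<^bsub>C\<^esub> h = slice_ext C E K f y \<cdot>\<^bsub>C\<^esub> q_map K x y)"

definition internal_hom_map ::  \<comment> \<open>\<open>f\<^bsub>x,y\<^esub>\<close>\<close>
  "('o, 'm) cat \<Rightarrow> 'm set \<Rightarrow> 'm set \<Rightarrow> ('o, 'm) choices \<Rightarrow> 'm \<Rightarrow> 'm \<Rightarrow> 'm \<Rightarrow> 'm" where
  "internal_hom_map C E E' K f x y = pi0_map C K (bracket_map C E E' K f x y)"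


section \<open>Existence of choices\<close>

definition empty_shape :: "(nat, nat) cat" where
  "empty_shape = \<lparr>Ob = {}, Ar = {}, Dom = id, Cod = id, Idm = id, Comp = (\<lambda>_. id)\<rparr>"

text \<open>Objects \<open>0, 1, 2\<close>; identities \<open>0, 1, 2\<close>; arrows \<open>3 : 0 \<rightarrow> 2\<close> and \<open>4 : 1 \<rightarrow> 2\<close>.\<close>

definition cospan_shape :: "(nat, nat) cat" where
  "cospan_shape = \<lparr>Ob = {0, 1, 2}, Ar = {0, 1, 2, 3, 4},
     Dom = (\<lambda>u. if u = 3 then 0 else if u = 4 then 1 else u),
     Cod = (\<lambda>u. if u = 3 \<or> u = 4 then 2 else u),
     Idm = id, Comp = (\<lambda>v u. if u \<ge> 3 then u else v)\<rparr>"

context balanced_factorization_category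
begin

lemma terminal_exists: "\<exists>T. is_terminal C T"
proof -
  have "category empty_shape"
    by unfold_locales (auto simp: empty_shape_def Hom_def)
  moreover have "is_functor empty_shape C undefined undefined"
    by (simp add: is_functor_def empty_shape_def)
  moreover have "finite (Ob empty_shape)" "finite (Ar empty_shape)"
    by (simp_all add: empty_shape_def)
  ultimately obtain L l where "is_limit empty_shape C undefined undefined L l"
    using finitely_complete unfolding finitely_complete_def by blast
  then have "is_terminal C L"
    by (auto simp: is_limit_def is_cone_def is_terminal_def empty_shape_def)
  then show ?thesis ..
qed

lemma pullback_exists:
  assumes f: "f \<in> Ar C" and g: "g \<in> Ar C" and fg: "Cod C f = Cod C g"
  shows "\<exists>p q. is_pullback C f g p q"
proof -
  let ?J = cospan_shape
  define Fo :: "nat \<Rightarrow> 'o" where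
    "Fo = (\<lambda>a. if a = 0 then Dom C f else if a = 1 then Dom C g else Cod C f)"
  define Fa where "Fa = (\<lambda>u::nat. if u = 3 then f else if u = 4 then g else Idm C (Fo u))"
  have fH: "f \<in> Hom C (Dom C f) (Cod C f)" and gH: "g \<in> Hom C (Dom C g) (Cod C f)"
    using assms by (auto simp: Hom_def)
  have obs: "Dom C f \<in> Ob C" "Dom C g \<in> Ob C" "Cod C f \<in> Ob C"
    using assms Dom_Ob Cod_Ob by auto
  have cat: "category ?J"
    by unfold_locales (auto simp: cospan_shape_def Hom_def)
  have "is_functor ?J C Fo Fa"
    unfolding is_functor_def
    using fH gH obs Idm_Hom Idm_left[OF fH] Idm_right[OF fH] Idm_left[OF gH] Idm_right[OF gH]
      Idm_left[OF Idm_Hom]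
    by (auto simp: cospan_shape_def Fo_def Fa_def)
  moreover have "finite (Ob ?J)" "finite (Ar ?J)" by (simp_all add: cospan_shape_def)
  ultimately obtain L l where lim: "is_limit ?J C Fo Fa L l"
    using finitely_complete cat unfolding finitely_complete_def by blast
  then have l: "l 0 \<in> Hom C L (Dom C f)" "l 1 \<in> Hom C L (Dom C g)" "l 2 \<in> Hom C L (Cod C f)"
    and lc: "f \<cdot> l 0 = l 2" "g \<cdot> l 1 = l 2"
    by (auto simp: is_limit_def is_cone_def cospan_shape_def Fo_def Fa_def)
  have univ: "\<exists>!h. h \<in> Hom C Z L \<and> l 0 \<cdot> h = a \<and> l 1 \<cdot> h = b"
    if a: "a \<in> Hom C Z (Dom C f)" and b: "b \<in> Hom C Z (Dom C g)" and ab: "f \<cdot> a = g \<cdot> b" for Z a b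
  proof -
    define n where "n = (\<lambda>k::nat. if k = 0 then a else if k = 1 then b else f \<cdot> a)"
    have fa: "f \<cdot> a \<in> Hom C Z (Cod C f)" using Comp_Hom[OF a fH] .
    have "Z \<in> Ob C" using a Dom_Ob by (auto simp: Hom_def)
    then have "is_cone ?J C Fo Fa Z n"
      using a b fa ab Idm_left[OF a] Idm_left[OF b] Idm_left[OF fa]
      by (auto simp: is_cone_def cospan_shape_def Fo_def Fa_def n_def)
    then have ex: "\<exists>!h. h \<in> Hom C Z L \<and> (\<forall>k \<in> Ob ?J. l k \<cdot> h = n k)"
      using lim unfolding is_limit_def by blast
    have "(\<forall>k \<in> Ob ?J. l k \<cdot> h = n k) \<longleftrightarrow> l 0 \<cdot> h = a \<and> l 1 \<cdot> h = b" if h: "h \<in> Hom C Z L" for h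
      using Comp_assoc[OF h l(1) fH] lc by (auto simp: cospan_shape_def n_def)
    then show ?thesis using ex by (metis (no_types, lifting))
  qed
  have "Dom C (l 0) = L" using l by (simp add: Hom_def)
  then have "is_pullback C f g (l 0) (l 1)"
    unfolding is_pullback_def using f g fg l lc univ by auto
  then show ?thesis by blast
qed

lemma reflection_exists:
  assumes T: "is_terminal C T" and X: "X \<in> Ob C"
  shows "\<exists>c. is_reflection C (internal_set C M T) X c"
proof -
  obtain t where t: "t \<in> Hom C X T" using T X unfolding is_terminal_def by blast
  then obtain e m where em: "is_factorization C E M t e m"
    using factorization_system unfolding factorization_system_def Hom_def by blast
  have e: "e \<in> Hom C X (Dom C m)" "e \<in> E" and m: "m \<in> Hom C (Dom C m) T" "m \<in> M"
    using em t by (auto simp: is_factorization_def Hom_def)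
  have De: "Dom C e = X" "Cod C e = Dom C m" using e by (auto simp: Hom_def)
  have P: "Dom C m \<in> Ob C" using m Dom_Ob by (auto simp: Hom_def)
  have "\<exists>!h. h \<in> Hom C (Dom C m) S \<and> h \<cdot> e = g"
    if S: "internal_set C M T S" and g: "g \<in> Hom C X S" for S g
  proof -
    obtain s where s: "s \<in> Hom C S T" "s \<in> M" using S by (auto simp: internal_set_def)
    have Ds: "Dom C s = S" "Cod C s = T" using s by (auto simp: Hom_def)
    have term_uniq: "u = v" if "u \<in> Hom C A T" "v \<in> Hom C A T" "A \<in> Ob C" for u v A
      using T that unfolding is_terminal_def by blast
    have "orthogonal C e s"
      using factorization_system e s unfolding factorization_system_def by blast
    moreover have "s \<cdot> g = m \<cdot> e"
      using term_uniq[OF Comp_Hom[OF g s(1)] Comp_Hom[OF e(1) m(1)] X] .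
    ultimately have ex: "\<exists>!d. d \<in> Hom C (Dom C m) S \<and> d \<cdot> e = g \<and> s \<cdot> d = m"
      using g m unfolding orthogonal_def De Ds by blast
    have "s \<cdot> d = m" if "d \<in> Hom C (Dom C m) S" for d
      using term_uniq[OF Comp_Hom[OF that s(1)] m(1) P] .
    then show ?thesis using ex by (metis (no_types, lifting))
  qed
  moreover have "internal_set C M T (Dom C m)"
    using P m by (auto simp: internal_set_def)
  ultimately have "is_reflection C (internal_set C M T) X e"
    unfolding is_reflection_def De using e by auto
  then show ?thesis ..
qed

lemma choices_exist: "\<exists>K. valid_choices C E M E' M' K"
proof -
  obtain T where T: "is_terminal C T" using terminal_exists ..
  obtain p q where pq: "\<And>f g. \<lbrakk>f \<in> Ar C; g \<in> Ar C; Cod C f = Cod C g\<rbrakk>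
      \<Longrightarrow> is_pullback C f g (p f g) (q f g)"
    using pullback_exists by metis
  obtain e m where em: "\<And>f. f \<in> Ar C \<Longrightarrow> is_factorization C E M f (e f) (m f)"
    using factorization_system unfolding factorization_system_def by metis
  obtain e' m' where em': "\<And>f. f \<in> Ar C \<Longrightarrow> is_factorization C E' M' f (e' f) (m' f)"
    using factorization_system' unfolding factorization_system_def by metis
  obtain c where c: "\<And>X. X \<in> Ob C \<Longrightarrow> is_reflection C (internal_set C M T) X (c X)"
    using reflection_exists[OF T] by metis
  have "valid_choices C E M E' M' \<lparr>one = T, pb1 = p, pb2 = q, facE = e, facM = m,
      facE' = e', facM' = m', refl_map = c\<rparr>"
    using T pq em em' c by (simp add: valid_choices_def)
  then show ?thesis ..
qed

end

end

(*
  The pullback i : S -> [x,y] of i_x is in E' and S is an internal set; so every map from S to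
  an internal set extends uniquely along i, and c i is an isomorphism. With ! the projection
  S -> 1, the square defining i gives p i = i_x !, whence
  p' f_[x,y] i = i_{f,x} i_x ! = i_{fx} !, so that f_[x,y] i factors through i' : S' -> [fx,fy].
  Composing with the reflections turns this into f_[x,y] i_{x,y} = i_{fx,fy} f_{x,y}, and the
  claim for left arrows follows by applying q'. The claim for right arrows is the same statement
  for the balanced factorization category with (E,M) and (E',M') exchanged.
*)
theory Submission
  imports Defs
begin

section \<open>Isomorphisms and pullbacks\<close>

context category
begin

lemma Hom_Ar: "f \<in> Hom C A B \<Longrightarrow> f \<in> Ar C"
  and Hom_Dom: "f \<in> Hom C A B \<Longrightarrow> Dom C f = A"
  and Hom_Cod: "f \<in> Hom C A B \<Longrightarrow> Cod C f = B"
  by (auto simp: Hom_def)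

lemma Hom_Ob_dom: "f \<in> Hom C A B \<Longrightarrow> A \<in> Ob C"
  and Hom_Ob_cod: "f \<in> Hom C A B \<Longrightarrow> B \<in> Ob C"
  using Dom_Ob Cod_Ob by (auto simp: Hom_def)

lemma terminal_Hom_unique:
  assumes "is_terminal C T" and "u \<in> Hom C A T" and "v \<in> Hom C A T"
  shows "u = v"
  using assms Hom_Ob_dom[OF assms(2)] unfolding is_terminal_def by blast

lemma inverse_arrowsI:
  assumes "f \<in> Hom C A B" and "g \<in> Hom C B A" and "g \<cdot> f = Idm C A" and "f \<cdot> g = Idm C B"
  shows "inverse_arrows C f g"
  using assms by (auto simp: inverse_arrows_def Hom_def)

lemma inverse_arrow:
  assumes iso: "is_iso C f" and f: "f \<in> Hom C A B"
  shows "inverse_arrow C f \<in> Hom C B A"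
    and "inverse_arrow C f \<cdot> f = Idm C A"
    and "f \<cdot> inverse_arrow C f = Idm C B"
proof -
  obtain g where g: "inverse_arrows C f g" using iso unfolding is_iso_def ..
  \<comment> \<open>\<open>inverse_arrow\<close> is a definite description, so uniqueness of the
    inverse is needed before anything can be said about it.\<close>
  have uniq: "h = g" if "inverse_arrows C f h" for h
  proof -
    have h: "h \<in> Hom C B A" "h \<cdot> f = Idm C A" and gh: "g \<in> Hom C B A" "f \<cdot> g = Idm C B"
      using that g Hom_Dom[OF f] Hom_Cod[OF f] by (auto simp: inverse_arrows_def)
    have "h = h \<cdot> (f \<cdot> g)" using Idm_right[OF h(1)] gh by simp
    also have "\<dots> = (h \<cdot> f) \<cdot> g" using Comp_assoc[OF gh(1) f h(1)] by simp
    also have "\<dots> = g" using h Idm_left[OF gh(1)] by simp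
    finally show ?thesis .
  qed
  have "inverse_arrow C f = g"
    unfolding inverse_arrow_def using g uniq by (rule the_equality)
  then show "inverse_arrow C f \<in> Hom C B A" "inverse_arrow C f \<cdot> f = Idm C A"
    "f \<cdot> inverse_arrow C f = Idm C B"
    using g Hom_Dom[OF f] Hom_Cod[OF f] by (auto simp: inverse_arrows_def)
qed

section \<open>Universal properties of pullbacks, fill-ins and reflections with explicit
  objects\<close>

lemma pullback_sym:
  assumes "is_pullback C f g p q"
  shows "is_pullback C g f q p"
proof -
  \<comment> \<open>The apex is encoded as the domain of the first projection; exchanging the
    projections is harmless because they share that domain.\<close>
  have q: "Dom C q = Dom C p" using assms by (auto simp: is_pullback_def Hom_def)
  show ?thesis
    using assms unfolding is_pullback_def q
    by (auto simp: conj_commute[of "p \<cdot> _ = _"] Ball_def eq_commute[of "g \<cdot> _"])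
qed

lemma pullback_Hom:
  assumes "is_pullback C f g p q" and "f \<in> Hom C A X" and "g \<in> Hom C B X"
  shows "p \<in> Hom C (Dom C p) A" and "q \<in> Hom C (Dom C p) B"
  using assms by (auto simp: is_pullback_def Hom_def)

lemma pullback_square: "is_pullback C f g p q \<Longrightarrow> f \<cdot> p = g \<cdot> q"
  by (simp add: is_pullback_def)

lemma pullback_universal:
  assumes "is_pullback C f g p q" and "f \<in> Hom C A X" and "g \<in> Hom C B X"
    and "a \<in> Hom C Z A" and "b \<in> Hom C Z B" and "f \<cdot> a = g \<cdot> b"
  shows "\<exists>!h. h \<in> Hom C Z (Dom C p) \<and> p \<cdot> h = a \<and> q \<cdot> h = b"
  using assms(1,4-6) Hom_Dom[OF assms(2)] Hom_Dom[OF assms(3)] unfolding is_pullback_def by blast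

lemma orthogonal_fill:
  assumes "orthogonal C e m" and "e \<in> Hom C A B" and "m \<in> Hom C P Q"
    and "a \<in> Hom C A P" and "b \<in> Hom C B Q" and "m \<cdot> a = b \<cdot> e"
  shows "\<exists>!d. d \<in> Hom C B P \<and> d \<cdot> e = a \<and> m \<cdot> d = b"
  using assms(1,4-6) Hom_Dom[OF assms(2)] Hom_Cod[OF assms(2)] Hom_Dom[OF assms(3)]
    Hom_Cod[OF assms(3)]
  unfolding orthogonal_def by blast

lemma reflection_extend:
  assumes "is_reflection C P A c" and "P S" and "g \<in> Hom C A S"
  shows "\<exists>!h. h \<in> Hom C (Cod C c) S \<and> h \<cdot> c = g"
  using assms unfolding is_reflection_def by blast

section \<open>Factorization systems\<close>

lemma factorization_system_orthogonal:
  "\<lbrakk>factorization_system C E M; e \<in> E; m \<in> M\<rbrakk> \<Longrightarrow> orthogonal C e m"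
  by (simp add: factorization_system_def)

lemma factorization_system_E_comp:
  assumes "factorization_system C E M" "e \<in> E" "e' \<in> E" "e \<in> Hom C A B" "e' \<in> Hom C B D"
  shows "e' \<cdot> e \<in> E"
  using assms by (auto simp: factorization_system_def Hom_def)

lemma factorization_system_M_comp:
  assumes "factorization_system C E M" "m \<in> M" "m' \<in> M" "m \<in> Hom C A B" "m' \<in> Hom C B D"
  shows "m' \<cdot> m \<in> M"
  using assms by (auto simp: factorization_system_def Hom_def)

lemma factorization_system_iso:
  assumes "factorization_system C E M" "inverse_arrows C f g"
  shows "f \<in> E" "f \<in> M"
  using assms by (auto simp: factorization_system_def is_iso_def)

lemma factorization_exists:
  assumes "factorization_system C E M" "f \<in> Hom C A B"
  obtains I e m where "e \<in> E" "m \<in> M" "e \<in> Hom C A I" "m \<in> Hom C I B" "m \<cdot> e = f"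
proof -
  have "f \<in> Ar C" using Hom_Ar[OF assms(2)] .
  then obtain e m where "is_factorization C E M f e m"
    using assms(1) unfolding factorization_system_def by blast
  then show thesis
    using that Hom_Dom[OF assms(2)] Hom_Cod[OF assms(2)] unfolding is_factorization_def by metis
qed

text \<open>Factor d as m e. Then d a has the two factorizations m (e a) and 1 (d a), both with left
  factor in \<open>E\<close> and right factor in \<open>M\<close>. Comparing them shows that m is an
  isomorphism, so d is a composite of two maps of \<open>E\<close>.\<close>

lemma factorization_system_E_cancel:
  assumes FS: "factorization_system C E M"
    and a: "a \<in> Hom C A B" "a \<in> E" and d: "d \<in> Hom C B D" and da: "d \<cdot> a \<in> E"
  shows "d \<in> E"
proof -
  obtain I e m where em: "e \<in> E" "m \<in> M" "e \<in> Hom C B I" "m \<in> Hom C I D" "m \<cdot> e = d"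
    using factorization_exists[OF FS d] .
  have ea: "e \<cdot> a \<in> Hom C A I" "e \<cdot> a \<in> E"
    using Comp_Hom[OF a(1) em(3)] factorization_system_E_comp[OF FS a(2) em(1) a(1) em(3)] by auto
  have daH: "d \<cdot> a \<in> Hom C A D" using Comp_Hom[OF a(1) d] .
  have mea: "m \<cdot> (e \<cdot> a) = d \<cdot> a" using Comp_assoc[OF a(1) em(3,4)] em(5) by simp
  have D: "Idm C D \<in> Hom C D D" and I: "Idm C I \<in> Hom C I I"
    using Idm_Hom Hom_Ob_cod[OF em(4)] Hom_Ob_dom[OF em(4)] by auto
  \<comment> \<open>The fill-in of the square with d a on the left and m on the right, whose top is
    e a and whose bottom is the identity; it is the candidate inverse of m.\<close>
  obtain s where s: "s \<in> Hom C D I" "s \<cdot> (d \<cdot> a) = e \<cdot> a" "m \<cdot> s = Idm C D"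
    using orthogonal_fill[OF factorization_system_orthogonal[OF FS da em(2)] daH em(4) ea(1) D]
      mea Idm_left[OF daH] by auto
  have sm: "s \<cdot> m \<in> Hom C I I" using Comp_Hom[OF em(4) s(1)] .
  have "(s \<cdot> m) \<cdot> (e \<cdot> a) = e \<cdot> a"
    using Comp_assoc[OF ea(1) em(4) s(1)] mea s(2) by simp
  moreover have "m \<cdot> (s \<cdot> m) = m"
    using Comp_assoc[OF em(4) s(1) em(4)] s(3) Idm_left[OF em(4)] by simp
  \<comment> \<open>Both s m and the identity fill the square from e a to m, so uniqueness gives the
    second inverse law.\<close>
  moreover have "\<exists>!t. t \<in> Hom C I I \<and> t \<cdot> (e \<cdot> a) = e \<cdot> a \<and> m \<cdot> t = m"
    using orthogonal_fill[OF factorization_system_orthogonal[OF FS ea(2) em(2)] ea(1) em(4) ea(1) em(4)]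
    by simp
  ultimately have "s \<cdot> m = Idm C I"
    using sm I Idm_left[OF ea(1)] Idm_right[OF em(4)] by blast
  then have "m \<in> E"
    using factorization_system_iso(1)[OF FS inverse_arrowsI[OF em(4) s(1)]] s(3) by simp
  then show ?thesis using factorization_system_E_comp[OF FS em(1) _ em(3,4)] em(5) by simp
qed

text \<open>Factor p as m e. Orthogonality extends q along e, and the universal property turns this
  extension and m into a map back to the apex, inverse to e. Hence p differs from m by an
  isomorphism.\<close>

lemma factorization_system_M_pullback:
  assumes FS: "factorization_system C E M"
    and pb: "is_pullback C u v p q" and u: "u \<in> Hom C A X" and v: "v \<in> Hom C B X" "v \<in> M"
  shows "p \<in> M"
proof -
  let ?R = "Dom C p"
  have p: "p \<in> Hom C ?R A" and q: "q \<in> Hom C ?R B" using pullback_Hom[OF pb u v(1)] .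
  have sq: "u \<cdot> p = v \<cdot> q" using pullback_square[OF pb] .
  obtain I e m where em: "e \<in> E" "m \<in> M" "e \<in> Hom C ?R I" "m \<in> Hom C I A" "m \<cdot> e = p"
    using factorization_exists[OF FS p] .
  have um: "u \<cdot> m \<in> Hom C I X" using Comp_Hom[OF em(4) u] .
  have "v \<cdot> q = (u \<cdot> m) \<cdot> e" using Comp_assoc[OF em(3,4) u] em(5) sq by simp
  then obtain d where d: "d \<in> Hom C I B" "d \<cdot> e = q" "v \<cdot> d = u \<cdot> m"
    using orthogonal_fill[OF factorization_system_orthogonal[OF FS em(1) v(2)] em(3) v(1) q um] by auto
  obtain r where r: "r \<in> Hom C I ?R" "p \<cdot> r = m" "q \<cdot> r = d"
    using pullback_universal[OF pb u v(1) em(4) d(1)] d(3) by auto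
  have re: "r \<cdot> e \<in> Hom C ?R ?R" and er: "e \<cdot> r \<in> Hom C I I"
    using Comp_Hom[OF em(3) r(1)] Comp_Hom[OF r(1) em(3)] .
  have idR: "Idm C ?R \<in> Hom C ?R ?R" and idI: "Idm C I \<in> Hom C I I"
    using Idm_Hom Hom_Ob_dom[OF p] Hom_Ob_dom[OF em(4)] by auto
  have "p \<cdot> (r \<cdot> e) = p" "q \<cdot> (r \<cdot> e) = q"
    using Comp_assoc[OF em(3) r(1) p] Comp_assoc[OF em(3) r(1) q] r em(5) d(2) by simp_all
  \<comment> \<open>One inverse law comes from uniqueness for the pullback; the other, below, from
    uniqueness of the fill-in between e and m.\<close>
  then have re_id: "r \<cdot> e = Idm C ?R"
    using pullback_universal[OF pb u v(1) p q sq] re idR Idm_right[OF p] Idm_right[OF q] by blast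
  have "(e \<cdot> r) \<cdot> e = e" using Comp_assoc[OF em(3) r(1) em(3)] re_id Idm_right[OF em(3)] by simp
  moreover have "m \<cdot> (e \<cdot> r) = m" using Comp_assoc[OF r(1) em(3,4)] em(5) r(2) by simp
  moreover have "\<exists>!t. t \<in> Hom C I I \<and> t \<cdot> e = e \<and> m \<cdot> t = m"
    using orthogonal_fill[OF factorization_system_orthogonal[OF FS em(1,2)] em(3,4) em(3,4)] by simp
  ultimately have "e \<cdot> r = Idm C I"
    using er idI Idm_left[OF em(3)] Idm_right[OF em(4)] by blast
  then have "e \<in> M"
    using factorization_system_iso(2)[OF FS inverse_arrowsI[OF em(3) r(1) re_id]] by simp
  then show ?thesis using factorization_system_M_comp[OF FS _ em(2) em(3,4)] em(5) by simp
qed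

text \<open>The common source of \<open>slice_ext\<close> and \<open>coslice_ext\<close>.
  Orthogonality alone gives a unique d satisfying the two equations, and right cancellation puts it
  in \<open>E\<close>, so the description that also demands membership in \<open>E\<close> denotes
  this d.\<close>

lemma factorization_comparison:
  assumes FS: "factorization_system C E M"
    and e: "e \<in> Hom C T A" "e \<in> E" and m: "m \<in> Hom C A X"
    and e': "e' \<in> Hom C T A'" "e' \<in> E" and m': "m' \<in> Hom C A' Y" "m' \<in> M"
    and f: "f \<in> Hom C X Y" and eq: "m' \<cdot> e' = f \<cdot> (m \<cdot> e)"
  defines "d \<equiv> THE d. d \<in> E \<and> d \<in> Hom C A A' \<and> m' \<cdot> d = f \<cdot> m \<and> d \<cdot> e = e'"
  shows "d \<in> Hom C A A'" and "m' \<cdot> d = f \<cdot> m" and "d \<cdot> e = e'"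
proof -
  have "m' \<cdot> e' = (f \<cdot> m) \<cdot> e" using Comp_assoc[OF e(1) m f] eq by simp
  then have ex: "\<exists>!d. d \<in> Hom C A A' \<and> d \<cdot> e = e' \<and> m' \<cdot> d = f \<cdot> m"
    by (rule orthogonal_fill[OF factorization_system_orthogonal[OF FS e(2) m'(2)] e(1) m'(1) e'(1)
        Comp_Hom[OF m f]])
  have "\<exists>!d. d \<in> E \<and> d \<in> Hom C A A' \<and> m' \<cdot> d = f \<cdot> m \<and> d \<cdot> e = e'"
    using ex factorization_system_E_cancel[OF FS e] e'(2) by (metis (no_types, lifting))
  from theI'[OF this] show "d \<in> Hom C A A'" "m' \<cdot> d = f \<cdot> m" "d \<cdot> e = e'"
    unfolding d_def by auto
qed

section \<open>Sections over a point\<close>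

text \<open>Below, \<open>b : T \<rightarrow> B\<close> stands for \<open>i\<^sub>x\<close> (or \<open>e\<^sub>y\<close>) and \<open>p : A \<rightarrow> B\<close> for the projection of
  \<open>[x,y]\<close>; \<open>i\<close> is the pullback of \<open>b\<close> along \<open>p\<close> and \<open>c\<close> the reflection of \<open>A\<close>.\<close>

lemma section_Hom:
  assumes "is_iso C (c \<cdot> i)" and "i \<in> Hom C S A" and "c \<in> Hom C A R"
  shows "i \<cdot> inverse_arrow C (c \<cdot> i) \<in> Hom C R A"
  using Comp_Hom[OF inverse_arrow(1)[OF assms(1) Comp_Hom[OF assms(2,3)]] assms(2)] .

text \<open>A point \<alpha> of R lifts to a point k of the fibre S of p over b. Since T is
  terminal, s k is the identity, so p i k = b s k = b; the commuting square u p = v q then shows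
  that q i k lies over u b.\<close>

lemma section_over_point:
  assumes T: "is_terminal C T"
    and b: "b \<in> Hom C T B" and p: "p \<in> Hom C A B" and pb: "is_pullback C b p s i"
    and c: "c \<in> Hom C A R" and iso: "is_iso C (c \<cdot> i)"
    and u: "u \<in> Hom C B X" and v: "v \<in> Hom C D X" and q: "q \<in> Hom C A D" and sq: "u \<cdot> p = v \<cdot> q"
    and \<alpha>: "\<alpha> \<in> Hom C T R"
  shows "q \<cdot> (i \<cdot> inverse_arrow C (c \<cdot> i)) \<cdot> \<alpha> \<in> Hom C T D"
    and "v \<cdot> (q \<cdot> (i \<cdot> inverse_arrow C (c \<cdot> i)) \<cdot> \<alpha>) = u \<cdot> b"
proof -
  let ?S = "Dom C s" and ?j = "inverse_arrow C (c \<cdot> i)"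
  have s: "s \<in> Hom C ?S T" and i: "i \<in> Hom C ?S A" using pullback_Hom[OF pb b p] .
  have j: "?j \<in> Hom C R ?S" using inverse_arrow(1)[OF iso Comp_Hom[OF i c]] .
  define k where "k = ?j \<cdot> \<alpha>"
  have k: "k \<in> Hom C T ?S" unfolding k_def using Comp_Hom[OF \<alpha> j] .
  have "q \<cdot> (i \<cdot> ?j) \<cdot> \<alpha> = q \<cdot> ((i \<cdot> ?j) \<cdot> \<alpha>)" using Comp_assoc[OF \<alpha> Comp_Hom[OF j i] q] .
  then have eq: "q \<cdot> (i \<cdot> ?j) \<cdot> \<alpha> = q \<cdot> (i \<cdot> k)" using Comp_assoc[OF \<alpha> j i] k_def by simp
  have ik: "i \<cdot> k \<in> Hom C T A" using Comp_Hom[OF k i] .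
  show "q \<cdot> (i \<cdot> ?j) \<cdot> \<alpha> \<in> Hom C T D" unfolding eq using Comp_Hom[OF ik q] .
  have sk: "s \<cdot> k = Idm C T"
    using terminal_Hom_unique[OF T Comp_Hom[OF k s]] Idm_Hom Hom_Ob_dom[OF b] by blast
  have "v \<cdot> (q \<cdot> (i \<cdot> k)) = u \<cdot> (p \<cdot> (i \<cdot> k))"
    using Comp_assoc[OF ik q v] Comp_assoc[OF ik p u] sq by simp
  also have "p \<cdot> (i \<cdot> k) = b \<cdot> (s \<cdot> k)"
    using Comp_assoc[OF k i p] Comp_assoc[OF k s b] pullback_square[OF pb] by simp
  also have "\<dots> = b" using sk Idm_right[OF b] by simp
  finally show "v \<cdot> (q \<cdot> (i \<cdot> ?j) \<cdot> \<alpha>) = u \<cdot> b" unfolding eq .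
qed

text \<open>Since d carries b to b', the map g carries the fibre of p over b to the fibre of p' over
  b'. This restriction k of g corresponds to h under the isomorphisms c i and c' i', which gives
  naturality of the sections.\<close>

lemma section_natural:
  assumes b: "b \<in> Hom C T B" and p: "p \<in> Hom C A B" and pb: "is_pullback C b p s i"
    and c: "c \<in> Hom C A R" and iso: "is_iso C (c \<cdot> i)"
    and b': "b' \<in> Hom C T B'" and p': "p' \<in> Hom C A' B'" and pb': "is_pullback C b' p' s' i'"
    and c': "c' \<in> Hom C A' R'" and iso': "is_iso C (c' \<cdot> i')"
    and d: "d \<in> Hom C B B'" "d \<cdot> b = b'" and g: "g \<in> Hom C A A'" "p' \<cdot> g = d \<cdot> p"
    and h: "h \<in> Hom C R R'" "h \<cdot> c = c' \<cdot> g"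
  shows "g \<cdot> (i \<cdot> inverse_arrow C (c \<cdot> i)) = (i' \<cdot> inverse_arrow C (c' \<cdot> i')) \<cdot> h"
proof -
  let ?S = "Dom C s" and ?j = "inverse_arrow C (c \<cdot> i)"
  let ?S' = "Dom C s'" and ?j' = "inverse_arrow C (c' \<cdot> i')"
  have s: "s \<in> Hom C ?S T" and i: "i \<in> Hom C ?S A" using pullback_Hom[OF pb b p] .
  have s': "s' \<in> Hom C ?S' T" and i': "i' \<in> Hom C ?S' A'" using pullback_Hom[OF pb' b' p'] .
  note ci = Comp_Hom[OF i c] and ci' = Comp_Hom[OF i' c']
  note j = inverse_arrow[OF iso ci] and j' = inverse_arrow[OF iso' ci']
  have gi: "g \<cdot> i \<in> Hom C ?S A'" using Comp_Hom[OF i g(1)] .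
  have "b' \<cdot> s = d \<cdot> (b \<cdot> s)" using Comp_assoc[OF s b d(1)] d(2) by simp
  also have "\<dots> = (d \<cdot> p) \<cdot> i" using pullback_square[OF pb] Comp_assoc[OF i p d(1)] by simp
  also have "\<dots> = p' \<cdot> (g \<cdot> i)" using g(2) Comp_assoc[OF i g(1) p'] by simp
  \<comment> \<open>The pair s, g i is a cone on b' and p'; k is the induced map between the
    fibres.\<close>
  finally obtain k where k: "k \<in> Hom C ?S ?S'" "i' \<cdot> k = g \<cdot> i"
    using pullback_universal[OF pb' b' p' s gi] by auto
  have "h \<cdot> (c \<cdot> i) = (c' \<cdot> g) \<cdot> i" using Comp_assoc[OF i c h(1)] h(2) by simp
  also have "\<dots> = (c' \<cdot> i') \<cdot> k"
    using Comp_assoc[OF i g(1) c'] Comp_assoc[OF k(1) i' c'] k(2) by simp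
  finally have hci: "h \<cdot> (c \<cdot> i) = (c' \<cdot> i') \<cdot> k" .
  \<comment> \<open>Cancelling the two isomorphisms in h (c i) = (c' i') k leaves an identity
    between the inverses.\<close>
  have "h = h \<cdot> (c \<cdot> i) \<cdot> ?j" using Comp_assoc[OF j(1) ci h(1)] j(3) Idm_right[OF h(1)] by simp
  also have "\<dots> = (c' \<cdot> i') \<cdot> (k \<cdot> ?j)" using hci Comp_assoc[OF j(1) k(1) ci'] by simp
  finally have "?j' \<cdot> h = (?j' \<cdot> (c' \<cdot> i')) \<cdot> (k \<cdot> ?j)"
    using Comp_assoc[OF Comp_Hom[OF j(1) k(1)] ci' j'(1)] by simp
  also have "\<dots> = k \<cdot> ?j" using j'(2) Idm_left[OF Comp_Hom[OF j(1) k(1)]] by simp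
  finally have kj: "?j' \<cdot> h = k \<cdot> ?j" .
  have "g \<cdot> (i \<cdot> ?j) = (i' \<cdot> k) \<cdot> ?j" using Comp_assoc[OF j(1) i g(1)] k(2) by simp
  also have "\<dots> = i' \<cdot> (?j' \<cdot> h)" using Comp_assoc[OF j(1) k(1) i'] kj by simp
  also have "\<dots> = (i' \<cdot> ?j') \<cdot> h" using Comp_assoc[OF h(1) j'(1) i'] by simp
  finally show ?thesis .
qed

end

section \<open>Internal sets\<close>

context balanced_factorization_category
begin

text \<open>The axioms are symmetric in the two systems; this transfers the isomorphism result for
  \<open>coslice_pt\<close> to \<open>slice_pt\<close>.\<close>

lemma dual: "balanced_factorization_category C E' M' E M"
  using finitely_complete factorization_system factorization_system' M_over_1 E_stable E'_stable
  by unfold_locales blast+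

text \<open>Hence the two systems have the same reflection, and a \<open>refl_map\<close> chosen
  with respect to \<open>M\<close> also serves the exchanged category.\<close>

lemma internal_set_dual: "is_terminal C T \<Longrightarrow> internal_set C M' T = internal_set C M T"
  using M_over_1 by (auto simp: internal_set_def fun_eq_iff)

text \<open>The map from S to the terminal object is also in \<open>M'\<close>, hence orthogonal to
  e. The lower triangle of the fill-in commutes automatically, since it ends in the terminal
  object.\<close>

lemma internal_set_extend:
  assumes T: "is_terminal C T" and S: "internal_set C M T S"
    and e: "e \<in> E'" "e \<in> Hom C A B" and g: "g \<in> Hom C A S"
  shows "\<exists>!h. h \<in> Hom C B S \<and> h \<cdot> e = g"
proof -
  obtain s where s: "s \<in> Hom C S T" "s \<in> M'"
    using S internal_set_dual[OF T] unfolding internal_set_def by metis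
  obtain t where t: "t \<in> Hom C B T" using T Hom_Ob_cod[OF e(2)] unfolding is_terminal_def by blast
  have "s \<cdot> g = t \<cdot> e" using terminal_Hom_unique[OF T Comp_Hom[OF g s(1)] Comp_Hom[OF e(2) t]] .
  then have "\<exists>!h. h \<in> Hom C B S \<and> h \<cdot> e = g \<and> s \<cdot> h = t"
    by (rule orthogonal_fill[OF factorization_system_orthogonal[OF factorization_system' e(1) s(2)]
        e(2) s(1) g t])
  moreover have "s \<cdot> h = t" if "h \<in> Hom C B S" for h
    using terminal_Hom_unique[OF T Comp_Hom[OF that s(1)] t] .
  ultimately show ?thesis by (metis (no_types, lifting))
qed

text \<open>Stability puts i in \<open>E'\<close>, and s is in \<open>M\<close> as a pullback of p,
  so S is an internal set. Maps from A to internal sets are thus determined by their restriction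
  along i, just as by their factorization through c.\<close>

lemma reflection_section_iso:
  assumes T: "is_terminal C T"
    and b: "b \<in> Hom C T B" "b \<in> E'" and p: "p \<in> Hom C A B" "p \<in> M"
    and pb: "is_pullback C b p s i"
    and c: "is_reflection C (internal_set C M T) A c"
  shows "is_iso C (c \<cdot> i)"
proof -
  let ?S = "Dom C s" and ?R = "Cod C c"
  have s: "s \<in> Hom C ?S T" and i: "i \<in> Hom C ?S A" using pullback_Hom[OF pb b(1) p(1)] .
  have iE: "i \<in> E'" using E'_stable[OF b(2) p(2) pb] .
  have "s \<in> M" using factorization_system_M_pullback[OF factorization_system pb b(1) p] .
  then have S: "internal_set C M T ?S"
    using s Hom_Ob_dom[OF s] by (auto simp: internal_set_def)
  have cH: "c \<in> Hom C A ?R" and R: "internal_set C M T ?R" using c by (auto simp: is_reflection_def)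
  have ci: "c \<cdot> i \<in> Hom C ?S ?R" using Comp_Hom[OF i cH] .
  \<comment> \<open>Extending the identity of S along i gives a retraction r; factoring r through c
    gives the inverse h of c i.\<close>
  obtain r where r: "r \<in> Hom C A ?S" "r \<cdot> i = Idm C ?S"
    using internal_set_extend[OF T S iE i Idm_Hom[OF Hom_Ob_dom[OF i]]] by auto
  obtain h where h: "h \<in> Hom C ?R ?S" "h \<cdot> c = r" using reflection_extend[OF c S r(1)] by auto
  have hci: "h \<cdot> (c \<cdot> i) = Idm C ?S" using Comp_assoc[OF i cH h(1)] h(2) r(2) by simp
  have cir: "(c \<cdot> i) \<cdot> r \<in> Hom C A ?R" using Comp_Hom[OF r(1) ci] .
  \<comment> \<open>The maps (c i) r and c into the internal set R agree after restriction along i,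
    so they coincide; uniqueness for c then yields the other inverse law.\<close>
  have "((c \<cdot> i) \<cdot> r) \<cdot> i = c \<cdot> i" using Comp_assoc[OF i r(1) ci] r(2) Idm_right[OF ci] by simp
  then have "(c \<cdot> i) \<cdot> r = c" using internal_set_extend[OF T R iE i ci] cir cH by blast
  then have "((c \<cdot> i) \<cdot> h) \<cdot> c = c" using Comp_assoc[OF cH h(1) ci] h(2) by simp
  then have "(c \<cdot> i) \<cdot> h = Idm C ?R"
    using reflection_extend[OF c R cH] Comp_Hom[OF h(1) ci] Idm_Hom[OF Hom_Ob_cod[OF cH]]
      Idm_left[OF cH] by blast
  then show ?thesis using inverse_arrowsI[OF ci h(1) hci] unfolding is_iso_def by blast
qed

end

section \<open>Internal hom-sets\<close>

locale chosen_balanced_factorization_category = balanced_factorization_category +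
  fixes K :: "('a, 'b) choices"
  assumes valid: "valid_choices C E M E' M' K"
begin

lemma one_terminal: "is_terminal C (one K)"
  using valid by (simp add: valid_choices_def)

lemma refl_map_reflection: "A \<in> Ob C \<Longrightarrow> is_reflection C (internal_set C M (one K)) A (refl_map K A)"
  using valid by (simp add: valid_choices_def)

lemma pb_pullback:
  "\<lbrakk>f \<in> Hom C A X; g \<in> Hom C B X\<rbrakk> \<Longrightarrow> is_pullback C f g (pb1 K f g) (pb2 K f g)"
  using valid by (simp add: valid_choices_def Hom_def)

section \<open>Slices, coslices and the maps between them induced by f\<close>

lemma slice_facts:
  assumes x: "x \<in> Hom C (one K) X"
  shows "slice_pt K x \<in> Hom C (one K) (slice C K x)" "slice_pt K x \<in> E"
    and "slice_map K x \<in> Hom C (slice C K x) X" "slice_map K x \<in> M"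
    and "slice_map K x \<cdot> slice_pt K x = x"
  using valid Hom_Ar[OF x] Hom_Dom[OF x] Hom_Cod[OF x]
  by (auto simp: valid_choices_def is_factorization_def slice_pt_def slice_map_def slice_def)

lemma coslice_facts:
  assumes x: "x \<in> Hom C (one K) X"
  shows "coslice_pt K x \<in> Hom C (one K) (coslice C K x)" "coslice_pt K x \<in> E'"
    and "coslice_map K x \<in> Hom C (coslice C K x) X" "coslice_map K x \<in> M'"
    and "coslice_map K x \<cdot> coslice_pt K x = x"
  using valid Hom_Ar[OF x] Hom_Dom[OF x] Hom_Cod[OF x]
  by (auto simp: valid_choices_def is_factorization_def coslice_pt_def coslice_map_def coslice_def)

lemma slice_ext:
  assumes f: "f \<in> Hom C X Y" and x: "x \<in> Hom C (one K) X"
  shows "slice_ext C E K f x \<in> Hom C (slice C K x) (slice C K (f \<cdot> x))"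
    and "slice_map K (f \<cdot> x) \<cdot> slice_ext C E K f x = f \<cdot> slice_map K x"
    and "slice_ext C E K f x \<cdot> slice_pt K x = slice_pt K (f \<cdot> x)"
proof -
  note X = slice_facts[OF x] and Y = slice_facts[OF Comp_Hom[OF x f]]
  have "slice_map K (f \<cdot> x) \<cdot> slice_pt K (f \<cdot> x) = f \<cdot> (slice_map K x \<cdot> slice_pt K x)"
    using X(5) Y(5) by simp
  note factorization_comparison[OF factorization_system X(1-3) Y(1-4) f this, folded slice_ext_def]
  then show "slice_ext C E K f x \<in> Hom C (slice C K x) (slice C K (f \<cdot> x))"
    "slice_map K (f \<cdot> x) \<cdot> slice_ext C E K f x = f \<cdot> slice_map K x"
    "slice_ext C E K f x \<cdot> slice_pt K x = slice_pt K (f \<cdot> x)" by auto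
qed

lemma coslice_ext:
  assumes f: "f \<in> Hom C X Y" and x: "x \<in> Hom C (one K) X"
  shows "coslice_ext C E' K f x \<in> Hom C (coslice C K x) (coslice C K (f \<cdot> x))"
    and "coslice_map K (f \<cdot> x) \<cdot> coslice_ext C E' K f x = f \<cdot> coslice_map K x"
    and "coslice_ext C E' K f x \<cdot> coslice_pt K x = coslice_pt K (f \<cdot> x)"
proof -
  note X = coslice_facts[OF x] and Y = coslice_facts[OF Comp_Hom[OF x f]]
  have "coslice_map K (f \<cdot> x) \<cdot> coslice_pt K (f \<cdot> x) = f \<cdot> (coslice_map K x \<cdot> coslice_pt K x)"
    using X(5) Y(5) by simp
  note factorization_comparison[OF factorization_system' X(1-3) Y(1-4) f this, folded coslice_ext_def]
  then show "coslice_ext C E' K f x \<in> Hom C (coslice C K x) (coslice C K (f \<cdot> x))"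
    "coslice_map K (f \<cdot> x) \<cdot> coslice_ext C E' K f x = f \<cdot> coslice_map K x"
    "coslice_ext C E' K f x \<cdot> coslice_pt K x = coslice_pt K (f \<cdot> x)" by auto
qed

section \<open>The object [x,y], its reflection and its two sections\<close>

lemma bracket_facts:
  assumes x: "x \<in> Hom C (one K) X" and y: "y \<in> Hom C (one K) X"
  shows "is_pullback C (coslice_map K x) (slice_map K y) (p_map K x y) (q_map K x y)"
    and "p_map K x y \<in> Hom C (bracket C K x y) (coslice C K x)" "p_map K x y \<in> M"
    and "q_map K x y \<in> Hom C (bracket C K x y) (slice C K y)" "q_map K x y \<in> M'"
proof -
  note X = coslice_facts[OF x] and Y = slice_facts[OF y]
  show pb: "is_pullback C (coslice_map K x) (slice_map K y) (p_map K x y) (q_map K x y)"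
    unfolding p_map_def q_map_def using pb_pullback[OF X(3) Y(3)] .
  show "p_map K x y \<in> Hom C (bracket C K x y) (coslice C K x)"
    "q_map K x y \<in> Hom C (bracket C K x y) (slice C K y)"
    unfolding bracket_def using pullback_Hom[OF pb X(3) Y(3)] .
  \<comment> \<open>The projections cross over: p is a pullback of the slice map and so lies in
    \<open>M\<close>, while q is a pullback of the coslice map and lies in \<open>M'\<close>. This
    is what stability of \<open>E'\<close> along p and of \<open>E\<close> along q requires.\<close>
  show "p_map K x y \<in> M"
    using factorization_system_M_pullback[OF factorization_system pb X(3) Y(3,4)] .
  show "q_map K x y \<in> M'"
    using factorization_system_M_pullback[OF factorization_system' pullback_sym[OF pb] Y(3) X(3,4)] .
qed

lemma c_map_reflection:
  assumes x: "x \<in> Hom C (one K) X" and y: "y \<in> Hom C (one K) X"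
  shows "is_reflection C (internal_set C M (one K)) (bracket C K x y) (c_map C K x y)"
  unfolding c_map_def using refl_map_reflection Hom_Ob_dom[OF bracket_facts(2)[OF x y]] by blast

lemma c_map_Hom:
  assumes "x \<in> Hom C (one K) X" and "y \<in> Hom C (one K) X"
  shows "c_map C K x y \<in> Hom C (bracket C K x y) (internal_hom C K x y)"
  using c_map_reflection[OF assms]
  by (simp add: is_reflection_def internal_hom_def pi0_ob_def c_map_def)

lemma i_iso:
  assumes x: "x \<in> Hom C (one K) X" and y: "y \<in> Hom C (one K) X"
  shows "is_iso C (c_map C K x y \<cdot> pb2 K (coslice_pt K x) (p_map K x y))"
  using reflection_section_iso[OF one_terminal coslice_facts(1,2)[OF x] bracket_facts(2,3)[OF x y]
      pb_pullback[OF coslice_facts(1)[OF x] bracket_facts(2)[OF x y]] c_map_reflection[OF x y]] .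

lemma e_iso:
  assumes x: "x \<in> Hom C (one K) X" and y: "y \<in> Hom C (one K) X"
  shows "is_iso C (c_map C K x y \<cdot> pb2 K (slice_pt K y) (q_map K x y))"
proof -
  interpret dual: balanced_factorization_category C E' M' E M using dual .
  show ?thesis
    \<comment> \<open>The dual statement speaks of reflections in the internal sets of
      \<open>M'\<close>, which are those of \<open>M\<close>.\<close>
    using dual.reflection_section_iso[OF one_terminal slice_facts(1,2)[OF y]
        bracket_facts(4,5)[OF x y] pb_pullback[OF slice_facts(1)[OF y] bracket_facts(4)[OF x y]]]
      c_map_reflection[OF x y] internal_set_dual[OF one_terminal] by simp
qed

section \<open>The maps that f induces on [x,y] and X(x,y)\<close>

lemma bracket_map:
  assumes f: "f \<in> Hom C X Y" and x: "x \<in> Hom C (one K) X" and y: "y \<in> Hom C (one K) X"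
  shows "bracket_map C E E' K f x y \<in> Hom C (bracket C K x y) (bracket C K (f \<cdot> x) (f \<cdot> y))"
    and "p_map K (f \<cdot> x) (f \<cdot> y) \<cdot> bracket_map C E E' K f x y
      = coslice_ext C E' K f x \<cdot> p_map K x y"
    and "q_map K (f \<cdot> x) (f \<cdot> y) \<cdot> bracket_map C E E' K f x y
      = slice_ext C E K f y \<cdot> q_map K x y"
proof -
  note fx = Comp_Hom[OF x f] and fy = Comp_Hom[OF y f]
  note B = bracket_facts[OF x y] and B' = bracket_facts[OF fx fy]
  note I = coslice_ext[OF f x] and S = slice_ext[OF f y]
  note U = coslice_facts(3) and V = slice_facts(3)
  \<comment> \<open>Both legs of the cone, mapped into Y, reduce to f after the square defining
    [x,y].\<close>
  have "coslice_map K (f \<cdot> x) \<cdot> (coslice_ext C E' K f x \<cdot> p_map K x y)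
      = f \<cdot> (coslice_map K x \<cdot> p_map K x y)"
    using Comp_assoc[OF B(2) I(1) U[OF fx]] I(2) Comp_assoc[OF B(2) U[OF x] f] by simp
  also have "\<dots> = f \<cdot> (slice_map K y \<cdot> q_map K x y)" using pullback_square[OF B(1)] by simp
  also have "\<dots> = slice_map K (f \<cdot> y) \<cdot> (slice_ext C E K f y \<cdot> q_map K x y)"
    using Comp_assoc[OF B(4) S(1) V[OF fy]] S(2) Comp_assoc[OF B(4) V[OF y] f] by simp
  finally have "\<exists>!h. h \<in> Hom C (bracket C K x y) (bracket C K (f \<cdot> x) (f \<cdot> y)) \<and>
      p_map K (f \<cdot> x) (f \<cdot> y) \<cdot> h = coslice_ext C E' K f x \<cdot> p_map K x y \<and>
      q_map K (f \<cdot> x) (f \<cdot> y) \<cdot> h = slice_ext C E K f y \<cdot> q_map K x y"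
    using pullback_universal[OF B'(1) U[OF fx] V[OF fy] Comp_Hom[OF B(2) I(1)] Comp_Hom[OF B(4) S(1)]]
    unfolding bracket_def[symmetric] by blast
  from theI'[OF this, folded bracket_map_def]
  show "bracket_map C E E' K f x y \<in> Hom C (bracket C K x y) (bracket C K (f \<cdot> x) (f \<cdot> y))"
    "p_map K (f \<cdot> x) (f \<cdot> y) \<cdot> bracket_map C E E' K f x y = coslice_ext C E' K f x \<cdot> p_map K x y"
    "q_map K (f \<cdot> x) (f \<cdot> y) \<cdot> bracket_map C E E' K f x y = slice_ext C E K f y \<cdot> q_map K x y"
    by auto
qed

lemma pi0_map:
  assumes g: "g \<in> Hom C A B"
  shows "pi0_map C K g \<in> Hom C (pi0_ob C K A) (pi0_ob C K B)"
    and "pi0_map C K g \<cdot> refl_map K A = refl_map K B \<cdot> g"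
proof -
  note A = refl_map_reflection[OF Hom_Ob_dom[OF g]] and B = refl_map_reflection[OF Hom_Ob_cod[OF g]]
  have B': "internal_set C M (one K) (pi0_ob C K B)" "refl_map K B \<in> Hom C B (pi0_ob C K B)"
    using B by (auto simp: is_reflection_def pi0_ob_def)
  have "\<exists>!h. h \<in> Hom C (pi0_ob C K A) (pi0_ob C K B) \<and> h \<cdot> refl_map K A = refl_map K B \<cdot> g"
    using reflection_extend[OF A B'(1) Comp_Hom[OF g B'(2)]] unfolding pi0_ob_def .
  from theI'[OF this] show "pi0_map C K g \<in> Hom C (pi0_ob C K A) (pi0_ob C K B)"
    "pi0_map C K g \<cdot> refl_map K A = refl_map K B \<cdot> g"
    unfolding pi0_map_def Hom_Dom[OF g] Hom_Cod[OF g] by auto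
qed

lemma internal_hom_map:
  assumes f: "f \<in> Hom C X Y" and x: "x \<in> Hom C (one K) X" and y: "y \<in> Hom C (one K) X"
  shows "internal_hom_map C E E' K f x y
      \<in> Hom C (internal_hom C K x y) (internal_hom C K (f \<cdot> x) (f \<cdot> y))"
    and "internal_hom_map C E E' K f x y \<cdot> c_map C K x y
      = c_map C K (f \<cdot> x) (f \<cdot> y) \<cdot> bracket_map C E E' K f x y"
  using pi0_map[OF bracket_map(1)[OF f x y]]
  by (simp_all add: internal_hom_map_def internal_hom_def c_map_def)

section \<open>Naturality of the two sections in f\<close>

lemma i_section_Hom:
  assumes x: "x \<in> Hom C (one K) X" and y: "y \<in> Hom C (one K) X"
  shows "i_section C K x y \<in> Hom C (internal_hom C K x y) (bracket C K x y)"
  unfolding i_section_def Let_def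
  using section_Hom[OF i_iso[OF x y] _ c_map_Hom[OF x y]]
    pullback_Hom(2)[OF pb_pullback] coslice_facts(1)[OF x] bracket_facts(2)[OF x y] by blast

lemma e_section_Hom:
  assumes x: "x \<in> Hom C (one K) X" and y: "y \<in> Hom C (one K) X"
  shows "e_section C K x y \<in> Hom C (internal_hom C K x y) (bracket C K x y)"
  unfolding e_section_def Let_def
  using section_Hom[OF e_iso[OF x y] _ c_map_Hom[OF x y]]
    pullback_Hom(2)[OF pb_pullback] slice_facts(1)[OF y] bracket_facts(4)[OF x y] by blast

lemma i_section_natural:
  assumes f: "f \<in> Hom C X Y" and x: "x \<in> Hom C (one K) X" and y: "y \<in> Hom C (one K) X"
  shows "bracket_map C E E' K f x y \<cdot> i_section C K x y
    = i_section C K (f \<cdot> x) (f \<cdot> y) \<cdot> internal_hom_map C E E' K f x y"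
proof -
  note fx = Comp_Hom[OF x f] and fy = Comp_Hom[OF y f]
  note b = coslice_facts(1) and p = bracket_facts(2)
  show ?thesis
    unfolding i_section_def Let_def
    \<comment> \<open>Here d is \<open>coslice_ext\<close>, which preserves the chosen points of the
      coslices; for the other section its role is played by \<open>slice_ext\<close>, with q in
      place of p.\<close>
    by (rule section_natural[OF b[OF x] p[OF x y] pb_pullback[OF b[OF x] p[OF x y]]
        c_map_Hom[OF x y] i_iso[OF x y]
        b[OF fx] p[OF fx fy] pb_pullback[OF b[OF fx] p[OF fx fy]] c_map_Hom[OF fx fy] i_iso[OF fx fy]
        coslice_ext(1,3)[OF f x] bracket_map(1,2)[OF f x y] internal_hom_map[OF f x y]])
qed

lemma e_section_natural:
  assumes f: "f \<in> Hom C X Y" and x: "x \<in> Hom C (one K) X" and y: "y \<in> Hom C (one K) X"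
  shows "bracket_map C E E' K f x y \<cdot> e_section C K x y
    = e_section C K (f \<cdot> x) (f \<cdot> y) \<cdot> internal_hom_map C E E' K f x y"
proof -
  note fx = Comp_Hom[OF x f] and fy = Comp_Hom[OF y f]
  note b = slice_facts(1) and q = bracket_facts(4)
  show ?thesis
    unfolding e_section_def Let_def
    by (rule section_natural[OF b[OF y] q[OF x y] pb_pullback[OF b[OF y] q[OF x y]]
        c_map_Hom[OF x y] e_iso[OF x y]
        b[OF fy] q[OF fx fy] pb_pullback[OF b[OF fy] q[OF fx fy]] c_map_Hom[OF fx fy] e_iso[OF fx fy]
        slice_ext(1,3)[OF f y] bracket_map(1,3)[OF f x y] internal_hom_map[OF f x y]])
qed

section \<open>Points of X(x,y) as left and right arrows\<close>

lemma left_arrow_of: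
  assumes x: "x \<in> Hom C (one K) X" and y: "y \<in> Hom C (one K) X"
    and \<alpha>: "\<alpha> \<in> Hom C (one K) (internal_hom C K x y)"
  shows "left_arrow_of C K x y \<alpha> \<in> left_arrows C K x y"
proof -
  note X = coslice_facts[OF x] and B = bracket_facts[OF x y]
  show ?thesis
    \<comment> \<open>The section has p-component \<open>coslice_pt K x\<close> at every point, so
      the left arrow lies over the image of \<open>coslice_pt K x\<close> in X, which is x.\<close>
    using section_over_point[OF one_terminal X(1) B(2) pb_pullback[OF X(1) B(2)] c_map_Hom[OF x y]
        i_iso[OF x y] X(3) slice_facts(3)[OF y] B(4) pullback_square[OF B(1)] \<alpha>] X(5)
    by (simp add: left_arrows_def left_arrow_of_def i_section_def Let_def)
qed

lemma right_arrow_of: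
  assumes x: "x \<in> Hom C (one K) X" and y: "y \<in> Hom C (one K) X"
    and \<alpha>: "\<alpha> \<in> Hom C (one K) (internal_hom C K x y)"
  shows "right_arrow_of C K x y \<alpha> \<in> right_arrows C K y x"
proof -
  note Y = slice_facts[OF y] and B = bracket_facts[OF x y]
  show ?thesis
    \<comment> \<open>The square defining [x,y] is read in the opposite direction: q is now the
      projection whose fibre over \<open>slice_pt K y\<close> is taken.\<close>
    using section_over_point[OF one_terminal Y(1) B(4) pb_pullback[OF Y(1) B(4)] c_map_Hom[OF x y]
        e_iso[OF x y] Y(3) coslice_facts(3)[OF x] B(2) pullback_square[OF B(1), symmetric] \<alpha>] Y(5)
    by (simp add: right_arrows_def right_arrow_of_def e_section_def Let_def)
qed

lemma left_image:
  assumes f: "f \<in> Hom C X Y" and y: "y \<in> Hom C (one K) X" and a: "a \<in> left_arrows C K x y"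
  shows "left_image C E K f y a \<in> left_arrows C K (f \<cdot> x) (f \<cdot> y)"
proof -
  have a: "a \<in> Hom C (one K) (slice C K y)" "slice_map K y \<cdot> a = x"
    using a by (auto simp: left_arrows_def)
  note S = slice_ext[OF f y]
  show ?thesis
    using Comp_Hom[OF a(1) S(1)] Comp_assoc[OF a(1) S(1) slice_facts(3)[OF Comp_Hom[OF y f]]]
      Comp_assoc[OF a(1) slice_facts(3)[OF y] f] S(2) a(2)
    by (simp add: left_arrows_def left_image_def)
qed

lemma right_image:
  assumes f: "f \<in> Hom C X Y" and x: "x \<in> Hom C (one K) X" and a: "a \<in> right_arrows C K y x"
  shows "right_image C E' K f x a \<in> right_arrows C K (f \<cdot> y) (f \<cdot> x)"
proof -
  have a: "a \<in> Hom C (one K) (coslice C K x)" "coslice_map K x \<cdot> a = y"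
    using a by (auto simp: right_arrows_def)
  note I = coslice_ext[OF f x]
  show ?thesis
    using Comp_Hom[OF a(1) I(1)] Comp_assoc[OF a(1) I(1) coslice_facts(3)[OF Comp_Hom[OF x f]]]
      Comp_assoc[OF a(1) coslice_facts(3)[OF x] f] I(2) a(2)
    by (simp add: right_arrows_def right_image_def)
qed

lemma left_arrow_of_natural:
  assumes f: "f \<in> Hom C X Y" and x: "x \<in> Hom C (one K) X" and y: "y \<in> Hom C (one K) X"
    and \<alpha>: "\<alpha> \<in> Hom C (one K) (internal_hom C K x y)"
  shows "left_arrow_of C K (f \<cdot> x) (f \<cdot> y) (internal_hom_map C E E' K f x y \<cdot> \<alpha>)
    = left_image C E K f y (left_arrow_of C K x y \<alpha>)"
proof -
  note fx = Comp_Hom[OF x f] and fy = Comp_Hom[OF y f]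
  note q = bracket_facts(4)[OF x y] and q' = bracket_facts(4)[OF fx fy]
  note i = i_section_Hom[OF x y] and i' = i_section_Hom[OF fx fy]
  note g = bracket_map[OF f x y] and h = internal_hom_map(1)[OF f x y] and e = slice_ext(1)[OF f y]
  let ?q' = "q_map K (f \<cdot> x) (f \<cdot> y)" and ?i' = "i_section C K (f \<cdot> x) (f \<cdot> y)"
  let ?g = "bracket_map C E E' K f x y" and ?h = "internal_hom_map C E E' K f x y"
  \<comment> \<open>Composition associates to the left, so rebracketing is needed to bring the
    section next to the induced map; naturality then exchanges them, and q' absorbs the bracket map
    into \<open>slice_ext\<close>.\<close>
  have "?q' \<cdot> ?i' \<cdot> (?h \<cdot> \<alpha>) = ?q' \<cdot> (?i' \<cdot> ?h) \<cdot> \<alpha>"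
    using Comp_assoc[OF \<alpha> h Comp_Hom[OF i' q']] Comp_assoc[OF h i' q'] by simp
  also have "\<dots> = ?q' \<cdot> ?g \<cdot> i_section C K x y \<cdot> \<alpha>"
    using i_section_natural[OF f x y] Comp_assoc[OF i g(1) q'] by simp
  also have "\<dots> = slice_ext C E K f y \<cdot> (q_map K x y \<cdot> i_section C K x y \<cdot> \<alpha>)"
    using g(3) Comp_assoc[OF i q e] Comp_assoc[OF \<alpha> Comp_Hom[OF i q] e] by simp
  finally show ?thesis unfolding left_arrow_of_def left_image_def .
qed

lemma right_arrow_of_natural:
  assumes f: "f \<in> Hom C X Y" and x: "x \<in> Hom C (one K) X" and y: "y \<in> Hom C (one K) X"
    and \<alpha>: "\<alpha> \<in> Hom C (one K) (internal_hom C K x y)"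
  shows "right_arrow_of C K (f \<cdot> x) (f \<cdot> y) (internal_hom_map C E E' K f x y \<cdot> \<alpha>)
    = right_image C E' K f x (right_arrow_of C K x y \<alpha>)"
proof -
  note fx = Comp_Hom[OF x f] and fy = Comp_Hom[OF y f]
  note p = bracket_facts(2)[OF x y] and p' = bracket_facts(2)[OF fx fy]
  note e = e_section_Hom[OF x y] and e' = e_section_Hom[OF fx fy]
  note g = bracket_map[OF f x y] and h = internal_hom_map(1)[OF f x y] and i = coslice_ext(1)[OF f x]
  let ?p' = "p_map K (f \<cdot> x) (f \<cdot> y)" and ?e' = "e_section C K (f \<cdot> x) (f \<cdot> y)"
  let ?g = "bracket_map C E E' K f x y" and ?h = "internal_hom_map C E E' K f x y"
  have "?p' \<cdot> ?e' \<cdot> (?h \<cdot> \<alpha>) = ?p' \<cdot> (?e' \<cdot> ?h) \<cdot> \<alpha>"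
    using Comp_assoc[OF \<alpha> h Comp_Hom[OF e' p']] Comp_assoc[OF h e' p'] by simp
  also have "\<dots> = ?p' \<cdot> ?g \<cdot> e_section C K x y \<cdot> \<alpha>"
    using e_section_natural[OF f x y] Comp_assoc[OF e g(1) p'] by simp
  also have "\<dots> = coslice_ext C E' K f x \<cdot> (p_map K x y \<cdot> e_section C K x y \<cdot> \<alpha>)"
    using g(2) Comp_assoc[OF e p i] Comp_assoc[OF \<alpha> Comp_Hom[OF e p] i] by simp
  finally show ?thesis unfolding right_arrow_of_def right_image_def .
qed

end

text \<open>The membership conjuncts ensure that the equations compare genuine arrows over the
  intended points. Since \<open>K\<close> is arbitrary, the result does not depend on how
  factorizations, pullbacks and reflections are chosen.\<close>

theorem mainTheorem12:
  fixes C :: "('o, 'm) cat" and E M E' M' :: "'m set" and K :: "('o, 'm) choices"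
    and X Y :: 'o and f x y :: 'm
  assumes "balanced_factorization_category C E M E' M'"
    and "valid_choices C E M E' M' K"
    and "f \<in> Hom C X Y"
    and "x \<in> Hom C (one K) X"
    and "y \<in> Hom C (one K) X"
  shows "\<forall>\<alpha> \<in> Hom C (one K) (internal_hom C K x y).
    (left_arrow_of C K x y \<alpha> \<in> left_arrows C K x y \<and>
     left_image C E K f y (left_arrow_of C K x y \<alpha>)
       \<in> left_arrows C K (f \<cdot>\<^bsub>C\<^esub> x) (f \<cdot>\<^bsub>C\<^esub> y) \<and>
     left_arrow_of C K (f \<cdot>\<^bsub>C\<^esub> x) (f \<cdot>\<^bsub>C\<^esub> y) (internal_hom_map C E E' K f x y \<cdot>\<^bsub>C\<^esub> \<alpha>)
       = left_image C E K f y (left_arrow_of C K x y \<alpha>)) \<and>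
    (right_arrow_of C K x y \<alpha> \<in> right_arrows C K y x \<and>
     right_image C E' K f x (right_arrow_of C K x y \<alpha>)
       \<in> right_arrows C K (f \<cdot>\<^bsub>C\<^esub> y) (f \<cdot>\<^bsub>C\<^esub> x) \<and>
     right_arrow_of C K (f \<cdot>\<^bsub>C\<^esub> x) (f \<cdot>\<^bsub>C\<^esub> y) (internal_hom_map C E E' K f x y \<cdot>\<^bsub>C\<^esub> \<alpha>)
       = right_image C E' K f x (right_arrow_of C K x y \<alpha>))"
proof -
  interpret balanced_factorization_category C E M E' M' by fact
  interpret chosen_balanced_factorization_category C E M E' M' K by unfold_locales fact
  note fxy = assms(3-5)
  show ?thesis
    using left_arrow_of[OF fxy(2,3)] left_image[OF fxy(1,3)] left_arrow_of_natural[OF fxy]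
      right_arrow_of[OF fxy(2,3)] right_image[OF fxy(1,2)] right_arrow_of_natural[OF fxy]
    by blast
qed

end
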